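(* Let $X$ and $Y$ be infinite totally ordered sets such that there exists a $\mathrm{TP}_2$ kernel on $X \times Y$. Then a function $F : (0,\infty) \to (0,\infty)$ has the property that $F \circ K$ is totally positive for every totally positive kernel $K$ on $X \times Y$ if and only if there exists $c > 0$ such that $F(x) = cx$ for all $x$.
   Context: For totally ordered sets $X$ and $Y$ and an integer $p \geq 1$, a kernel $K : X \times Y \to \mathbb{R}$ is $\mathrm{TP}_p$ if $\det(K(x_i, y_j))_{i,j=1}^n > 0$ for all $1 \leq n \leq p$ and all $x_1 < \cdots < x_n$ in $X$ and $y_1 < \cdots < y_n$ in $Y$. It is totally positive ($\mathrm{TP}$) if it is $\mathrm{TP}_p$ for all $p \geq 1$. *)

theory Defs
  imports "Jordan_Normal_Form.Determinant"
begin

text \<open>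
  A totally ordered set is a subset of a type of class \<^class>\<open>linorder\<close>, with the induced order.
  A kernel on \<open>X \<times> Y\<close> is a total function on pairs, and only its values on \<open>X \<times> Y\<close> matter.
  The points are indexed from \<open>0\<close> to \<open>n - 1\<close> because that is how \<^const>\<open>mat\<close> indexes entries.
\<close>

definition TP_order ::
  "nat \<Rightarrow> 'a::linorder set \<Rightarrow> 'b::linorder set \<Rightarrow> ('a \<times> 'b \<Rightarrow> real) \<Rightarrow> bool" where
  "TP_order p X Y K \<longleftrightarrow>
     (\<forall>n x y. 1 \<le> n \<longrightarrow> n \<le> p \<longrightarrow>
        x ` {..<n} \<subseteq> X \<longrightarrow> strict_mono_on {..<n} x \<longrightarrow>
        y ` {..<n} \<subseteq> Y \<longrightarrow> strict_mono_on {..<n} y \<longrightarrow>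
        det (mat n n (\<lambda>(i, j). K (x i, y j))) > 0)"

definition totally_positive ::
  "'a::linorder set \<Rightarrow> 'b::linorder set \<Rightarrow> ('a \<times> 'b \<Rightarrow> real) \<Rightarrow> bool" where
  "totally_positive X Y K \<longleftrightarrow> (\<forall>p\<ge>1. TP_order p X Y K)"

end

theory Submission
  imports Defs "HOL-Real_Asymp.Real_Asymp"
begin

text \<open>
  A \<open>TP\<^sub>2\<close> kernel embeds \<open>X\<close> and \<open>Y\<close> order-isomorphically into \<open>(0, 1)\<close>, through quotients of two of its
  rows or columns. Every positive \<open>2 \<times> 2\<close> matrix with positive determinant is then a submatrix of a
  kernel \<open>exp (A + B s + C t + D s t)\<close> with \<open>D > 0\<close>, which is totally positive. Hence \<open>G = ln \<circ> F \<circ> exp\<close>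
  satisfies \<open>G b + G c < G a + G d\<close> whenever \<open>b + c < a + d\<close>, which forces \<open>G\<close> to be affine, so that
  \<open>F x = c x\<^sup>\<alpha>\<close> with \<open>\<alpha> > 0\<close>.

  To exclude \<open>\<alpha> \<noteq> 1\<close>, consider \<open>K(u, v) = 1 + d u v / (1 - u v) + b u\<^sup>2 v + y u\<^sup>2 v\<^sup>3\<close> on \<open>(0, 1)\<^sup>2\<close>. It
  has the form \<open>\<Sum>k. f\<^sub>k(u) g\<^sub>k(v)\<close> with positive minors on both sides, so it is totally positive by the
  Cauchy-Binet formula. If \<open>K\<^sup>\<alpha>\<close> is also totally positive, then letting four values of \<open>u\<close> shrink to \<open>0\<close>
  shows that the matrix of the first four Taylor coefficients in \<open>u\<close> of \<open>K(u, v\<^sub>j)\<^sup>\<alpha>\<close>, \<open>j < 4\<close>, has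
  nonnegative determinant. This determinant is explicit; it is negative for \<open>\<alpha> > 1\<close>, \<open>d = y = 1\<close> and \<open>b\<close>
  large, and for \<open>\<alpha> < 1\<close>, \<open>b = y = 0\<close> and \<open>d = 6 / (1 - \<alpha>)\<close>.
\<close>

subsection \<open>Determinants of kernels\<close>

lemma det_mat_leibniz:
  "det (mat n n (\<lambda>(i, j). M i j)) =
     (\<Sum>p | p permutes {0..<n}. signof p * (\<Prod>i=0..<n. M i (p i)))"
proof -
  have "p i < n" if "p permutes {0..<n}" "i < n" for p i
    using permutes_in_image[OF that(1), of i] that(2) by simp
  then show ?thesis
    by (subst det_def'[of _ n]) (auto intro!: sum.cong prod.cong arg_cong2[where f = "(*)"])
qed

lemma det_scale_rows_cols:
  fixes f g :: "nat \<Rightarrow> 'a::comm_ring_1"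
  shows "det (mat n n (\<lambda>(i, j). f i * g j * M i j)) =
           (\<Prod>i<n. f i) * (\<Prod>j<n. g j) * det (mat n n (\<lambda>(i, j). M i j))"
proof -
  have "signof p * (\<Prod>i=0..<n. f i * g (p i) * M i (p i)) =
          (\<Prod>i<n. f i) * (\<Prod>j<n. g j) * (signof p * (\<Prod>i=0..<n. M i (p i)))"
    if "p permutes {0..<n}" for p
  proof -
    have "(\<Prod>i=0..<n. g (p i)) = (\<Prod>j=0..<n. g j)"
      using prod.permute[OF that, of g] by (simp add: o_def)
    then show ?thesis
      by (simp add: prod.distrib atLeast0LessThan mult_ac)
  qed
  then show ?thesis
    by (simp add: det_mat_leibniz sum_distrib_left)
qed

text \<open>Rolle's theorem, by induction on the number of exponents. Factoring out
  \<open>exp (x * t 0)\<close> makes the lowest term constant, so the derivative of the quotient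
  \<open>h\<close> is an exponential sum with one exponent fewer and a positive top coefficient. It
  vanishes between consecutive \<open>\<sigma> i\<close>, hence is positive beyond the last of them,
  and \<open>h\<close> increases from zero there.\<close>

lemma exp_sum_pos:
  fixes c t :: "nat \<Rightarrow> real"
  assumes "strict_mono_on {..n} t" and "c n > 0" and "strict_mono_on {..<n} \<sigma>"
    and "\<And>i. i < n \<Longrightarrow> (\<Sum>j\<le>n. c j * exp (\<sigma> i * t j)) = 0"
    and "\<And>i. i < n \<Longrightarrow> \<sigma> i < s"
  shows "(\<Sum>j\<le>n. c j * exp (s * t j)) > 0"
  using assms
proof (induction n arbitrary: c t \<sigma> s)
  case 0
  then show ?case by simp
next
  case (Suc n)
  define h where "h x = (\<Sum>j\<le>Suc n. c j * exp (x * (t j - t 0)))" for x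
  define h' where "h' x = (\<Sum>j\<le>n. c (Suc j) * (t (Suc j) - t 0) * exp (x * (t (Suc j) - t 0)))" for x
  have h_eq: "(\<Sum>j\<le>Suc n. c j * exp (x * t j)) = exp (x * t 0) * h x" for x
    unfolding h_def sum_distrib_left
    by (intro sum.cong refl) (simp add: exp_diff right_diff_distrib)
  have h_deriv: "(h has_real_derivative h' x) (at x)" for x
  proof -
    have "(h has_real_derivative (\<Sum>j\<le>Suc n. c j * (t j - t 0) * exp (x * (t j - t 0)))) (at x)"
      unfolding h_def by (auto intro!: derivative_eq_intros sum.cong)
    then show ?thesis
      unfolding h'_def sum.atMost_Suc_shift by simp
  qed
  have h_zero: "h (\<sigma> i) = 0" if "i < Suc n" for i
    using Suc.prems(4)[OF that] h_eq[of "\<sigma> i"] by simp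
  have "\<exists>x. \<sigma> i < x \<and> x < \<sigma> (Suc i) \<and> h' x = 0" if "i < n" for i
  proof -
    have lt: "\<sigma> i < \<sigma> (Suc i)"
      using strict_mono_onD[OF Suc.prems(3), of i "Suc i"] that by simp
    have "\<exists>x>\<sigma> i. x < \<sigma> (Suc i) \<and> h (\<sigma> (Suc i)) - h (\<sigma> i) = (\<sigma> (Suc i) - \<sigma> i) * h' x"
      by (rule MVT2[OF lt]) (use h_deriv in auto)
    then show ?thesis
      using h_zero[of i] h_zero[of "Suc i"] lt that by auto
  qed
  then obtain \<tau> where \<tau>: "\<And>i. i < n \<Longrightarrow> \<sigma> i < \<tau> i \<and> \<tau> i < \<sigma> (Suc i) \<and> h' (\<tau> i) = 0"
    by metis
  have \<sigma>_mono: "\<sigma> i \<le> \<sigma> j" if "i \<le> j" "j \<le> n" for i j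
    using strict_mono_onD[OF Suc.prems(3), of i j] that by (cases "i = j") auto
  have h'_pos: "h' x > 0" if "\<sigma> n < x" for x
    unfolding h'_def
  proof (rule Suc.IH)
    show "strict_mono_on {..n} (\<lambda>j. t (Suc j) - t 0)"
      using Suc.prems(1) by (auto simp: strict_mono_on_def)
    show "c (Suc n) * (t (Suc n) - t 0) > 0"
      using Suc.prems(2) strict_mono_onD[OF Suc.prems(1), of 0 "Suc n"] by simp
    show "strict_mono_on {..<n} \<tau>"
    proof (rule strict_mono_onI)
      fix i j assume "i \<in> {..<n}" "j \<in> {..<n}" "i < j"
      then show "\<tau> i < \<tau> j"
        using \<tau>[of i] \<tau>[of j] \<sigma>_mono[of "Suc i" j] by auto
    qed
    show "\<tau> i < x" if "i < n" for i
      using \<tau>[OF that] \<sigma>_mono[of "Suc i" n] that \<open>\<sigma> n < x\<close> by auto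
  qed (use \<tau> in \<open>auto simp: h'_def\<close>)
  have "\<exists>x>\<sigma> n. x < s \<and> h s - h (\<sigma> n) = (s - \<sigma> n) * h' x"
    by (rule MVT2) (use h_deriv Suc.prems(5)[of n] in auto)
  then have "h s > 0"
    using h_zero[of n] h'_pos Suc.prems(5)[of n] by auto
  then show ?case by (simp only: h_eq) simp
qed

text \<open>Expanded along its last row, the determinant is an exponential sum in the last point. It
  vanishes when that point repeats an earlier one, and its top coefficient is the determinant of
  size \<open>n\<close>, so \<open>exp_sum_pos\<close> applies.\<close>

lemma det_exp_kernel_pos:
  fixes s t :: "nat \<Rightarrow> real"
  assumes "strict_mono_on {..<n} s" and "strict_mono_on {..<n} t"
  shows "det (mat n n (\<lambda>(i, j). exp (s i * t j))) > 0"
  using assms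
proof (induction n)
  case 0
  then show ?case by simp
next
  case (Suc n)
  \<comment> \<open>In \<open>A r\<close> the last point is replaced by \<open>s r\<close>; the
    cofactors of the last row are the same for every \<open>r\<close>.\<close>
  define A where "A r = mat (Suc n) (Suc n) (\<lambda>(i, j). exp (s (if i = n then r else i) * t j))" for r
  define c where "c j = cofactor (A n) n j" for j
  have cof: "cofactor (A r) n j = c j" if "j < Suc n" for r j
    unfolding c_def cofactor_def mat_delete_def A_def
    by (intro arg_cong2[where f = "(*)"] refl arg_cong[where f = det] eq_matI) auto
  have expand: "det (A r) = (\<Sum>j\<le>n. c j * exp (s r * t j))" for r
    by (subst laplace_expansion_row[of _ "Suc n" n])
       (auto simp: cof lessThan_Suc_atMost intro!: sum.cong, auto simp: A_def mult.commute)
  have "(\<Sum>j\<le>n. c j * exp (s n * t j)) > 0"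
  proof (rule exp_sum_pos)
    show "strict_mono_on {..n} t"
      using Suc.prems(2) by (simp add: lessThan_Suc_atMost)
    show "strict_mono_on {..<n} s"
      using Suc.prems(1) by (auto simp: strict_mono_on_def)
    have "mat_delete (A n) n n = mat n n (\<lambda>(i, j). exp (s i * t j))"
      unfolding mat_delete_def A_def by (rule eq_matI) auto
    moreover have "det (mat n n (\<lambda>(i, j). exp (s i * t j))) > 0"
      by (rule Suc.IH) (use Suc.prems in \<open>auto simp: strict_mono_on_def\<close>)
    ultimately show "c n > 0"
      by (simp add: c_def cofactor_def)
    show "(\<Sum>j\<le>n. c j * exp (s i * t j)) = 0" if "i < n" for i
      unfolding expand[symmetric]
      by (rule det_identical_rows[of _ "Suc n" i n]) (use that in \<open>auto simp: A_def\<close>)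
    show "s i < s n" if "i < n" for i
      using strict_mono_onD[OF Suc.prems(1), of i n] that by simp
  qed
  also have "(\<Sum>j\<le>n. c j * exp (s n * t j)) = det (A n)"
    by (rule expand[symmetric])
  also have "A n = mat (Suc n) (Suc n) (\<lambda>(i, j). exp (s i * t j))"
    unfolding A_def by (rule eq_matI) auto
  finally show ?case .
qed


section \<open>Limits of determinants, the Cauchy-Binet formula and monomial minors\<close>

lemma tendsto_det:
  fixes L :: "nat \<Rightarrow> nat \<Rightarrow> real"
  assumes "\<And>i j. i < n \<Longrightarrow> j < n \<Longrightarrow> ((\<lambda>x. M x i j) \<longlongrightarrow> L i j) F"
  shows "((\<lambda>x. det (mat n n (\<lambda>(i, j). M x i j))) \<longlongrightarrow> det (mat n n (\<lambda>(i, j). L i j))) F"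
proof -
  have "p i < n" if "p permutes {0..<n}" "i < n" for p i
    using permutes_in_image[OF that(1), of i] that(2) by simp
  then show ?thesis
    unfolding det_mat_leibniz by (auto intro!: tendsto_intros assms)
qed

lemma det_mat_permute_rows:
  assumes "q permutes {0..<n}"
  shows "det (mat n n (\<lambda>(i, j). M (q i) j)) = signof q * det (mat n n (\<lambda>(i, j). M i j))"
proof -
  have "mat n n (\<lambda>(i, j). M (q i) j) = mat n n (\<lambda>(i, j). mat n n (\<lambda>(i, j). M i j) $$ (q i, j))"
    using permutes_in_image[OF assms] by (intro eq_matI) auto
  then show ?thesis
    using det_permute_rows[of "mat n n (\<lambda>(i, j). M i j)" n q] assms by simp
qed

text \<open>
  Summing over all maps \<open>z\<close> instead of over the increasing ones counts every minor \<open>n!\<close> times, but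
  avoids the bijection between injections and pairs of a subset and a permutation.
\<close>

lemma Cauchy_Binet_symmetric:
  fixes f g :: "nat \<Rightarrow> nat \<Rightarrow> real"
  shows "fact n * det (mat n n (\<lambda>(i, j). \<Sum>k<N. f k i * g k j)) =
    (\<Sum>z\<in>{0..<n} \<rightarrow>\<^sub>E {..<N}.
       det (mat n n (\<lambda>(a, i). f (z a) i)) * det (mat n n (\<lambda>(a, j). g (z a) j)))"
proof -
  let ?Z = "{0..<n} \<rightarrow>\<^sub>E {..<N}" and ?P = "{p. p permutes {0..<n}}"
  define G where "G z = det (mat n n (\<lambda>(a, j). g (z a) j))" for z :: "nat \<Rightarrow> nat"
  define D where "D = det (mat n n (\<lambda>(i, j). \<Sum>k<N. f k i * g k j))"
  have "D = (\<Sum>p\<in>?P. signof p * (\<Sum>z\<in>?Z. \<Prod>i=0..<n. f (z i) i * g (z i) (p i)))"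
    unfolding D_def det_mat_leibniz by (subst prod_sum_PiE) auto
  also have "\<dots> = (\<Sum>z\<in>?Z. (\<Prod>i=0..<n. f (z i) i) * G z)"
    unfolding G_def det_mat_leibniz sum_distrib_left prod.distrib
    by (subst sum.swap) (simp add: mult_ac)
  finally have D_eq: "D = (\<Sum>z\<in>?Z. (\<Prod>i=0..<n. f (z i) i) * G z)" .
  \<comment> \<open>Reindexing \<open>z\<close> by \<open>q\<close> leaves \<open>D\<close>
    unchanged and produces the sign of \<open>q\<close>; summing over all \<open>q\<close> then
    assembles the determinant of the \<open>f (z a) i\<close>.\<close>
  have D_perm: "D = (\<Sum>z\<in>?Z. signof q * (\<Prod>i=0..<n. f (z (q i)) i) * G z)" if q: "q \<in> ?P" for q
  proof -
    have q': "q permutes {0..<n}" "inv_into UNIV q permutes {0..<n}"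
      using q permutes_inv by auto
    have comp_in: "z \<circ> r \<in> ?Z" if "z \<in> ?Z" "r permutes {0..<n}" for z r
      using that permutes_in_image[OF that(2)] permutes_not_in[OF that(2)]
      by (auto simp: PiE_iff extensional_def)
    have G_perm: "G (z \<circ> q) = signof q * G z" for z
      unfolding G_def using det_mat_permute_rows[OF q'(1), of "\<lambda>a j. g (z a) j"] by simp
    have "D = (\<Sum>z\<in>?Z. (\<Prod>i=0..<n. f ((z \<circ> q) i) i) * G (z \<circ> q))"
      unfolding D_eq
      by (rule sum.reindex_bij_witness[of _ "\<lambda>z. z \<circ> q" "\<lambda>z. z \<circ> inv_into UNIV q"])
         (use comp_in q' in \<open>auto simp: comp_assoc permutes_inv_o\<close>)
    also have "\<dots> = (\<Sum>z\<in>?Z. signof q * (\<Prod>i=0..<n. f (z (q i)) i) * G z)"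
      unfolding G_perm comp_apply by (intro sum.cong refl) (simp only: mult_ac)
    finally show ?thesis .
  qed
  have "fact n * D = (\<Sum>q\<in>?P. D)"
    by (simp add: card_permutations[of "{0..<n}" n])
  also have "\<dots> = (\<Sum>q\<in>?P. \<Sum>z\<in>?Z. signof q * (\<Prod>i=0..<n. f (z (q i)) i) * G z)"
    by (intro sum.cong refl D_perm)
  also have "\<dots> = (\<Sum>z\<in>?Z. det (mat n n (\<lambda>(i, a). f (z a) i)) * G z)"
    unfolding det_mat_leibniz sum_distrib_right by (rule sum.swap)
  finally have "fact n * D = (\<Sum>z\<in>?Z. det (mat n n (\<lambda>(i, a). f (z a) i)) * G z)" .
  moreover have "det (mat n n (\<lambda>(i, a). f (z a) i)) = det (mat n n (\<lambda>(a, i). f (z a) i))" for z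
  proof -
    have "transpose_mat (mat n n (\<lambda>(a, i). f (z a) i)) = mat n n (\<lambda>(i, a). f (z a) i)"
      by (rule eq_matI) auto
    then show ?thesis
      using det_transpose[of "mat n n (\<lambda>(a, i). f (z a) i)" n] by simp
  qed
  ultimately show ?thesis
    unfolding D_def G_def by simp
qed

lemma ex_sorting_permutation:
  fixes z :: "nat \<Rightarrow> nat"
  assumes "inj_on z {..<n}"
  obtains q where "q permutes {0..<n}" and "strict_mono_on {..<n} (z \<circ> q)"
proof -
  have "card (z ` {..<n}) = n"
    by (simp add: card_image assms)
  then obtain r where r: "strict_mono_on {..<n} r" "\<And>i. i < n \<Longrightarrow> r i \<in> z ` {..<n}"
    using finite_enumerate[of "z ` {..<n}"] by auto
  define q where "q i = (if i < n then inv_into {..<n} z (r i) else i)" for i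
  have zq: "q i < n \<and> z (q i) = r i" if "i < n" for i
    using that inv_into_into[OF r(2)[OF that]] f_inv_into_f[OF r(2)[OF that]] by (auto simp: q_def)
  have "inj_on q {0..<n}"
  proof (rule inj_onI)
    fix i j assume "i \<in> {0..<n}" "j \<in> {0..<n}" "q i = q j"
    then have "r i = r j" "i < n" "j < n"
      using zq[of i] zq[of j] by auto
    then show "i = j"
      using strict_mono_on_imp_inj_on[OF r(1)] by (auto dest: inj_onD)
  qed
  moreover have "q ` {0..<n} \<subseteq> {0..<n}"
    using zq by auto
  ultimately have "bij_betw q {0..<n} {0..<n}"
    by (simp add: bij_betw_def endo_inj_surj)
  then have "q permutes {0..<n}"
    by (rule bij_imp_permutes) (simp add: q_def)
  moreover have "strict_mono_on {..<n} (z \<circ> q)"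
    using r(1) zq by (auto simp: strict_mono_on_def)
  ultimately show thesis ..
qed

text \<open>No term of the Cauchy-Binet sum is negative: for injective \<open>z\<close>, sorting
  changes both minors by the same sign, and otherwise a row repeats. Keeping the term of the
  identity gives a lower bound that does not depend on \<open>N\<close>, so strict positivity
  survives the limit in \<open>N\<close>.\<close>

lemma det_sum_products_ge:
  fixes f g :: "nat \<Rightarrow> nat \<Rightarrow> real"
  assumes f: "\<And>z. strict_mono_on {..<n} z \<Longrightarrow> det (mat n n (\<lambda>(a, i). f (z a) i)) \<ge> 0"
    and g: "\<And>z. strict_mono_on {..<n} z \<Longrightarrow> det (mat n n (\<lambda>(a, j). g (z a) j)) \<ge> 0"
    and "n \<le> N"
  shows "det (mat n n (\<lambda>(a, i). f a i)) * det (mat n n (\<lambda>(a, j). g a j))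
           \<le> fact n * det (mat n n (\<lambda>(i, j). \<Sum>k<N. f k i * g k j))"
proof -
  define T where
    "T z = det (mat n n (\<lambda>(a, i). f (z a) i)) * det (mat n n (\<lambda>(a, j). g (z a) j))" for z
  have T_nonneg: "T z \<ge> 0" for z
  proof (cases "inj_on z {..<n}")
    case True
    then obtain q where q: "q permutes {0..<n}" "strict_mono_on {..<n} (z \<circ> q)"
      by (rule ex_sorting_permutation)
    have "T (z \<circ> q) = (signof q)\<^sup>2 * T z"
      unfolding T_def comp_apply det_mat_permute_rows[OF q(1), of "\<lambda>a. f (z a)"]
        det_mat_permute_rows[OF q(1), of "\<lambda>a. g (z a)"] by (simp only: power2_eq_square mult_ac)
    also have "(signof q :: real)\<^sup>2 = 1"
      by (simp add: sign_def)
    finally show ?thesis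
      using mult_nonneg_nonneg[OF f[OF q(2)] g[OF q(2)]] unfolding T_def by simp
  next
    case False
    then obtain a b where "a < n" "b < n" "a \<noteq> b" "z a = z b"
      by (auto simp: inj_on_def)
    then have "det (mat n n (\<lambda>(a, i). f (z a) i)) = 0"
      by (intro det_identical_rows[of _ n a b]) auto
    then show ?thesis by (simp add: T_def)
  qed
  let ?id = "restrict id {0..<n}"
  have "T ?id \<le> (\<Sum>z\<in>{0..<n} \<rightarrow>\<^sub>E {..<N}. T z)"
    by (rule member_le_sum) (use T_nonneg \<open>n \<le> N\<close> in \<open>auto intro!: finite_PiE\<close>)
  also have "T ?id = det (mat n n (\<lambda>(a, i). f a i)) * det (mat n n (\<lambda>(a, j). g a j))"
    unfolding T_def by (intro arg_cong2[where f = "(*)"] arg_cong[where f = det] eq_matI) auto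
  finally show ?thesis
    unfolding T_def Cauchy_Binet_symmetric .
qed

text \<open>A generalized Vandermonde determinant is an exponential one, with nodes
  \<open>z a\<close> and \<open>ln (u i)\<close>.\<close>

lemma det_monomials_pos:
  fixes u :: "nat \<Rightarrow> real"
  assumes "strict_mono_on {..<n} z" and "strict_mono_on {..<n} u" and "\<And>i. i < n \<Longrightarrow> u i > 0"
  shows "det (mat n n (\<lambda>(a, i). u i ^ z a)) > 0"
proof -
  have "det (mat n n (\<lambda>(a, i). exp (real (z a) * ln (u i)))) > 0"
    using assms by (intro det_exp_kernel_pos) (auto simp: strict_mono_on_def)
  also have "mat n n (\<lambda>(a, i). exp (real (z a) * ln (u i))) = mat n n (\<lambda>(a, i). u i ^ z a)"
    using assms(3) by (intro eq_matI) (auto simp: exp_of_nat_mult)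
  finally show ?thesis .
qed

subsection \<open>The test kernel\<close>

text \<open>In the basis of monomials the coefficient matrix of these functions is diagonal except
  for the entry \<open>\<beta>\<close> in position \<open>(m, m + 1)\<close>.\<close>

definition shear :: "(nat \<Rightarrow> real) \<Rightarrow> nat \<Rightarrow> real \<Rightarrow> nat \<Rightarrow> real \<Rightarrow> real" where
  "shear d m \<beta> k x = d k * x ^ k + (if k = m then \<beta> * x ^ Suc m else 0)"

text \<open>Linearity in the row with \<open>z a = m\<close> splits the determinant. One part is a
  positive multiple of a monomial minor. In the other the exponent \<open>m\<close> becomes
  \<open>m + 1\<close>: it vanishes if that exponent already occurs, and otherwise the exponents
  stay increasing.\<close>

lemma det_shear_pos:
  assumes "strict_mono_on {..<n} z" and "strict_mono_on {..<n} u" and "\<And>i. i < n \<Longrightarrow> u i > 0"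
    and d: "\<And>k. d k > 0" and "\<beta> \<ge> 0"
  shows "det (mat n n (\<lambda>(a, i). shear d m \<beta> (z a) (u i))) > 0"
proof -
  \<comment> \<open>The flag \<open>b\<close> selects which summand of \<open>shear\<close> is used
    in the row with \<open>z a = m\<close>; \<open>c\<close> holds the coefficients and
    \<open>w\<close> the exponents.\<close>
  define c where "c b a = (if a < n \<and> z a = m \<and> b then \<beta> else d (z a))" for b a
  define w where "w b a = (if a < n \<and> z a = m \<and> b then Suc m else z a)" for b a
  define M where "M b = mat n n (\<lambda>(a, i). c b a * u i ^ w b a)" for b
  have det_M: "det (M b) = (\<Prod>a<n. c b a) * det (mat n n (\<lambda>(a, i). u i ^ w b a))" for b
    using det_scale_rows_cols[of n "c b" "\<lambda>_. 1" "\<lambda>a i. u i ^ w b a"] by (simp add: M_def)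
  have M_pos: "det (M False) > 0"
    unfolding det_M c_def w_def
    using d det_monomials_pos[OF assms(1-3)] by (auto intro!: mult_pos_pos prod_pos)
  show ?thesis
  proof (cases "\<exists>a<n. z a = m")
    case False
    then have "mat n n (\<lambda>(a, i). shear d m \<beta> (z a) (u i)) = M False"
      by (intro eq_matI) (auto simp: M_def shear_def c_def w_def)
    then show ?thesis using M_pos by simp
  next
    case True
    then obtain a0 where a0: "a0 < n" "z a0 = m" by blast
    have a0_iff: "z a = m \<longleftrightarrow> a = a0" if "a < n" for a
      using a0 that strict_mono_on_imp_inj_on[OF assms(1)] by (auto dest: inj_onD)
    have split: "mat n n (\<lambda>(a, i). shear d m \<beta> (z a) (u i)) =
        mat\<^sub>r n n (\<lambda>a. if a = a0 then row (M False) a + row (M True) a else row (M False) a)"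
      by (rule eq_matI) (use a0 a0_iff in \<open>auto simp: M_def shear_def c_def w_def\<close>)
    have rows: "mat\<^sub>r n n (\<lambda>a. if a = a0 then row (M b) a else row (M False) a) = M b" for b
      by (rule eq_matI) (use a0_iff in \<open>auto simp: M_def c_def w_def\<close>)
    have carrier: "row (M b) a \<in> carrier_vec n" for b a
      unfolding M_def by (intro carrier_vecI) simp
    have "det (mat n n (\<lambda>(a, i). shear d m \<beta> (z a) (u i))) = det (M False) + det (M True)"
      unfolding split
      by (subst det_row_add) (use carrier a0 in \<open>auto simp only: rows\<close>)
    moreover have "det (M True) \<ge> 0"
    proof -
      have "det (mat n n (\<lambda>(a, i). u i ^ w True a)) \<ge> 0"
      proof (cases "\<exists>a<n. z a = Suc m")
        case True
        then obtain a1 where "a1 < n" "z a1 = Suc m" by blast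
        then have "det (mat n n (\<lambda>(a, i). u i ^ w True a)) = 0"
          using a0 by (intro det_identical_rows[of _ n a0 a1]) (auto simp: w_def)
        then show ?thesis by simp
      next
        case False
        have "strict_mono_on {..<n} (w True)"
        proof (rule strict_mono_onI)
          fix a a' assume *: "a \<in> {..<n}" "a' \<in> {..<n}" "a < a'"
          then have "z a < z a'"
            using strict_mono_onD[OF assms(1)] by blast
          then show "w True a < w True a'"
            using False * by (force simp: w_def)
        qed
        then show ?thesis
          using det_monomials_pos[OF _ assms(2,3)] by (simp add: less_imp_le)
      qed
      then show ?thesis
        unfolding det_M c_def
        using d \<open>\<beta> \<ge> 0\<close> by (auto intro!: mult_nonneg_nonneg prod_nonneg simp: less_imp_le)
    qed
    ultimately show ?thesis using M_pos by simp
  qed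
qed

definition test_kernel :: "real \<Rightarrow> real \<Rightarrow> real \<Rightarrow> real \<Rightarrow> real \<Rightarrow> real" where
  "test_kernel d b y u v = 1 + d * (u * v / (1 - u * v)) + b * u\<^sup>2 * v + y * u\<^sup>2 * v ^ 3"

text \<open>Two products leave the diagonal: \<open>k = 1\<close> yields
  \<open>b * u\<^sup>2 * v\<close>, and \<open>k = 2\<close> yields \<open>d * u\<^sup>2\<close>
  times \<open>(y / d) * v ^ 3\<close>, which explains the quotient \<open>y / d\<close>.\<close>

lemma test_kernel_sums:
  assumes "d > 0" and "u \<in> {0<..<1}" and "v \<in> {0<..<1}"
  shows "(\<lambda>k. shear (\<lambda>k. if k = 0 then 1 else d) 1 b k u * shear (\<lambda>_. 1) 2 (y / d) k v)
           sums test_kernel d b y u v"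
proof -
  have lt1: "\<bar>u * v\<bar> < 1"
    using assms mult_strict_mono[of u 1 v 1] by (auto simp: abs_mult)
  have sing: "(\<lambda>k. if k = m then c else 0) sums c" for m :: nat and c :: real
    using sums_single[of m "\<lambda>_. c"] by simp
  \<comment> \<open>The geometric series contributes \<open>d\<close> at \<open>k = 0\<close>, where
    the kernel has 1; the term \<open>1 - d\<close> corrects this.\<close>
  have "(\<lambda>k. d * (u * v) ^ k + (if k = 0 then 1 - d else 0) + (if k = 1 then b * u\<^sup>2 * v else 0)
          + (if k = 2 then y * u\<^sup>2 * v ^ 3 else 0))
        sums (d * (1 / (1 - u * v)) + (1 - d) + b * u\<^sup>2 * v + y * u\<^sup>2 * v ^ 3)"
    using lt1 by (intro sums_add sums_mult sing geometric_sums) simp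
  moreover have "d * (1 / (1 - u * v)) + (1 - d) + b * u\<^sup>2 * v + y * u\<^sup>2 * v ^ 3 = test_kernel d b y u v"
    using lt1 by (simp add: test_kernel_def field_simps)
  moreover have "(\<lambda>k. d * (u * v) ^ k + (if k = 0 then 1 - d else 0) + (if k = 1 then b * u\<^sup>2 * v else 0)
          + (if k = 2 then y * u\<^sup>2 * v ^ 3 else 0)) =
      (\<lambda>k. shear (\<lambda>k. if k = 0 then 1 else d) 1 b k u * shear (\<lambda>_. 1) 2 (y / d) k v)"
    using \<open>d > 0\<close>
    by (auto simp: fun_eq_iff shear_def power_mult_distrib eval_nat_numeral algebra_simps)
  ultimately show ?thesis by simp
qed

lemma det_test_kernel_pos:
  assumes "d > 0" "b \<ge> 0" "y \<ge> 0"
    and u: "strict_mono_on {..<n} u" "\<And>i. i < n \<Longrightarrow> u i \<in> {0<..<1}"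
    and v: "strict_mono_on {..<n} v" "\<And>j. j < n \<Longrightarrow> v j \<in> {0<..<1}"
  shows "det (mat n n (\<lambda>(i, j). test_kernel d b y (u i) (v j))) > 0"
proof -
  define f where "f k i = shear (\<lambda>k. if k = 0 then 1 else d) 1 b k (u i)" for k i
  define g where "g k j = shear (\<lambda>_. 1) 2 (y / d) k (v j)" for k j
  define L where "L = det (mat n n (\<lambda>(a, i). f a i)) * det (mat n n (\<lambda>(a, j). g a j))"
  have f_pos: "det (mat n n (\<lambda>(a, i). f (z a) i)) > 0" if "strict_mono_on {..<n} z" for z
    unfolding f_def by (rule det_shear_pos) (use assms that in auto)
  have g_pos: "det (mat n n (\<lambda>(a, i). g (z a) i)) > 0" if "strict_mono_on {..<n} z" for z
    unfolding g_def by (rule det_shear_pos) (use assms that in auto)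
  have "((\<lambda>N. det (mat n n (\<lambda>(i, j). \<Sum>k<N. f k i * g k j)))
          \<longlonglongrightarrow> det (mat n n (\<lambda>(i, j). test_kernel d b y (u i) (v j))))"
    by (rule tendsto_det, unfold f_def g_def, rule test_kernel_sums[unfolded sums_def]) (use assms in auto)
  moreover have "\<forall>\<^sub>F N in sequentially. L / fact n \<le> det (mat n n (\<lambda>(i, j). \<Sum>k<N. f k i * g k j))"
    using eventually_ge_at_top[of n]
  proof eventually_elim
    case (elim N)
    have "L \<le> fact n * det (mat n n (\<lambda>(i, j). \<Sum>k<N. f k i * g k j))"
      unfolding L_def by (rule det_sum_products_ge) (use f_pos g_pos elim in \<open>auto intro: less_imp_le\<close>)
    then show ?case by (simp add: divide_le_eq mult.commute)
  qed
  ultimately have "L / fact n \<le> det (mat n n (\<lambda>(i, j). test_kernel d b y (u i) (v j)))"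
    by (rule tendsto_lowerbound) simp
  moreover have "L > 0"
    unfolding L_def using f_pos[of id] g_pos[of id] by (simp add: strict_mono_on_def)
  ultimately show ?thesis
    by (smt (verit) divide_pos_pos fact_gt_zero)
qed

subsection \<open>Taylor coefficients of powers of the test kernel\<close>

text \<open>Row \<open>k\<close> of the inverse Vandermonde matrix \<open>W\<close> reads off the
  coefficient of \<open>x ^ k\<close> of a polynomial of degree below \<open>n\<close> from its
  values at the \<open>s i\<close>.\<close>

lemma ex_Vandermonde_inverse:
  fixes s :: "nat \<Rightarrow> real"
  assumes "strict_mono_on {..<n} s" and "\<And>i. i < n \<Longrightarrow> s i > 0"
  obtains W where "det (mat n n (\<lambda>(k, i). W k i)) > 0"
    and "\<And>k l. k < n \<Longrightarrow> l < n \<Longrightarrow> (\<Sum>i<n. W k i * s i ^ l) = (if k = l then 1 else 0)"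
proof -
  define S where "S = mat n n (\<lambda>(i, k). s i ^ k)"
  have S_carrier: "S \<in> carrier_mat n n"
    by (simp add: S_def)
  have "transpose_mat (mat n n (\<lambda>(k, i). s i ^ id k)) = S"
    unfolding S_def by (rule eq_matI) auto
  then have "det S = det (mat n n (\<lambda>(k, i). s i ^ id k))"
    using det_transpose[of "mat n n (\<lambda>(k, i). s i ^ id k)" n] by simp
  also have "\<dots> > 0"
    using assms by (intro det_monomials_pos) (auto simp: strict_mono_on_def)
  finally have S_pos: "det S > 0" .
  define W where "W k i = adj_mat S $$ (k, i) / det S" for k i
  have adj_dim: "adj_mat S \<in> carrier_mat n n"
    by (rule adj_mat(1)[OF S_carrier])
  have W_mult: "mat n n (\<lambda>(k, i). W k i) * S = 1\<^sub>m n"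
  proof -
    have "mat n n (\<lambda>(k, i). W k i) = (1 / det S) \<cdot>\<^sub>m adj_mat S"
      using adj_dim by (intro eq_matI) (auto simp: W_def)
    then have "mat n n (\<lambda>(k, i). W k i) * S = (1 / det S) \<cdot>\<^sub>m (adj_mat S * S)"
      using mult_smult_assoc_mat[OF adj_dim S_carrier] by simp
    also have "\<dots> = 1\<^sub>m n"
      unfolding adj_mat(3)[OF S_carrier] using S_pos by (intro eq_matI) auto
    finally show ?thesis .
  qed
  have "det (mat n n (\<lambda>(k, i). W k i)) * det S = 1"
    using det_mult[of "mat n n (\<lambda>(k, i). W k i)" n S] S_carrier W_mult by simp
  then have "det (mat n n (\<lambda>(k, i). W k i)) > 0"
    using S_pos zero_less_mult_pos2[of "det (mat n n (\<lambda>(k, i). W k i))" "det S"] by simp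
  moreover have "(\<Sum>i<n. W k i * s i ^ l) = (if k = l then 1 else 0)" if "k < n" "l < n" for k l
  proof -
    have "(mat n n (\<lambda>(k, i). W k i) * S) $$ (k, l) = (\<Sum>i<n. W k i * s i ^ l)"
      using that by (simp add: S_def scalar_prod_def atLeast0LessThan)
    then show ?thesis
      using that by (simp add: W_mult)
  qed
  ultimately show thesis ..
qed

text \<open>Applying \<open>W\<close> to the values \<open>H j (\<epsilon> * s i)\<close> turns row
  \<open>k\<close> into \<open>\<epsilon> ^ k\<close> times \<open>h k j + o(1)\<close>. The
  determinant of the product is positive; removing the powers of \<open>\<epsilon>\<close> and
  letting \<open>\<epsilon>\<close> tend to 0 leaves a nonnegative limit.\<close>

lemma det_Taylor_coeffs_nonneg:
  fixes H :: "nat \<Rightarrow> real \<Rightarrow> real" and h :: "nat \<Rightarrow> nat \<Rightarrow> real"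
  assumes s: "strict_mono_on {..<n} s" "\<And>i. i < n \<Longrightarrow> s i > 0"
    and Taylor: "\<And>j. j < n \<Longrightarrow>
      ((\<lambda>x. (H j x - (\<Sum>k<n. h k j * x ^ k)) / x ^ (n - 1)) \<longlongrightarrow> 0) (at_right 0)"
    and pos: "\<forall>\<^sub>F \<epsilon> in at_right 0. det (mat n n (\<lambda>(i, j). H j (\<epsilon> * s i))) > 0"
  shows "det (mat n n (\<lambda>(k, j). h k j)) \<ge> 0"
proof -
  obtain W where W_pos: "det (mat n n (\<lambda>(k, i). W k i)) > 0"
    and W: "\<And>k l. k < n \<Longrightarrow> l < n \<Longrightarrow> (\<Sum>i<n. W k i * s i ^ l) = (if k = l then 1 else 0)"
    using ex_Vandermonde_inverse[OF s] by metis
  define R where "R j x = H j x - (\<Sum>k<n. h k j * x ^ k)" for j x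
  \<comment> \<open>The error in row \<open>k\<close> after division by
    \<open>\<epsilon> ^ k\<close>; it vanishes in the limit because \<open>R j x\<close> is
    \<open>o(x ^ (n - 1))\<close> and \<open>k \<le> n - 1\<close>.\<close>
  define N where "N \<epsilon> k j = (\<Sum>i<n. W k i * (R j (\<epsilon> * s i) / \<epsilon> ^ k))" for \<epsilon> k j
  have N_lim: "((\<lambda>\<epsilon>. N \<epsilon> k j) \<longlongrightarrow> 0) (at_right 0)" if "k < n" "j < n" for k j
  proof -
    have "((\<lambda>\<epsilon>. R j (\<epsilon> * s i) / \<epsilon> ^ k) \<longlongrightarrow> 0) (at_right 0)" if "i < n" for i
    proof -
      have "filterlim (\<lambda>\<epsilon>. \<epsilon> * s i) (at_right 0) (at_right 0)"
        using s(2)[OF that] by real_asymp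
      with Taylor[OF \<open>j < n\<close>]
      have "((\<lambda>\<epsilon>. R j (\<epsilon> * s i) / (\<epsilon> * s i) ^ (n - 1)) \<longlongrightarrow> 0) (at_right 0)"
        unfolding R_def by (rule filterlim_compose)
      then have "((\<lambda>\<epsilon>. R j (\<epsilon> * s i) / (\<epsilon> * s i) ^ (n - 1) * (s i ^ (n - 1) * \<epsilon> ^ (n - 1 - k)))
          \<longlongrightarrow> 0 * (s i ^ (n - 1) * 0 ^ (n - 1 - k))) (at_right 0)"
        by (intro tendsto_intros)
      moreover have "\<forall>\<^sub>F \<epsilon> in at_right 0. R j (\<epsilon> * s i) / (\<epsilon> * s i) ^ (n - 1) * (s i ^ (n - 1) * \<epsilon> ^ (n - 1 - k))
          = R j (\<epsilon> * s i) / \<epsilon> ^ k"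
        using eventually_at_right_less[of 0]
      proof eventually_elim
        case (elim \<epsilon>)
        have "\<epsilon> ^ (n - 1) = \<epsilon> ^ k * \<epsilon> ^ (n - 1 - k)"
          using \<open>k < n\<close> by (simp flip: power_add)
        then show ?case
          using elim s(2)[OF that] by (simp add: power_mult_distrib field_simps)
      qed
      ultimately show ?thesis
        by (simp add: tendsto_cong)
    qed
    then have "((\<lambda>\<epsilon>. N \<epsilon> k j) \<longlongrightarrow> (\<Sum>i<n. W k i * 0)) (at_right 0)"
      unfolding N_def by (intro tendsto_intros) auto
    then show ?thesis by simp
  qed
  \<comment> \<open>The factor 1 gives the entries the shape of
    \<open>det_scale_rows_cols\<close>.\<close>
  have prod_eq: "mat n n (\<lambda>(k, i). W k i) * mat n n (\<lambda>(i, j). H j (\<epsilon> * s i)) =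
      mat n n (\<lambda>(k, j). \<epsilon> ^ k * 1 * (h k j + N \<epsilon> k j))" if "\<epsilon> > 0" for \<epsilon>
  proof (rule eq_matI)
    fix k j assume "k < dim_row (mat n n (\<lambda>(k, j). \<epsilon> ^ k * 1 * (h k j + N \<epsilon> k j)))"
      "j < dim_col (mat n n (\<lambda>(k, j). \<epsilon> ^ k * 1 * (h k j + N \<epsilon> k j)))"
    then have kj: "k < n" "j < n" by auto
    have "(\<Sum>i<n. W k i * H j (\<epsilon> * s i)) =
        (\<Sum>i<n. W k i * (\<Sum>l<n. h l j * (\<epsilon> * s i) ^ l)) + (\<Sum>i<n. W k i * R j (\<epsilon> * s i))"
      unfolding R_def sum.distrib[symmetric] by (simp add: algebra_simps)
    also have "(\<Sum>i<n. W k i * (\<Sum>l<n. h l j * (\<epsilon> * s i) ^ l)) =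
        (\<Sum>l<n. h l j * \<epsilon> ^ l * (\<Sum>i<n. W k i * s i ^ l))"
      unfolding sum_distrib_left by (subst sum.swap) (simp add: power_mult_distrib mult_ac)
    also have "\<dots> = (\<Sum>l<n. if k = l then h l j * \<epsilon> ^ l else 0)"
      by (rule sum.cong) (use W kj in auto)
    also have "\<dots> = h k j * \<epsilon> ^ k"
      using kj by simp
    also have "(\<Sum>i<n. W k i * R j (\<epsilon> * s i)) = \<epsilon> ^ k * N \<epsilon> k j"
      unfolding N_def sum_distrib_left using that by (simp add: field_simps)
    finally show "(mat n n (\<lambda>(k, i). W k i) * mat n n (\<lambda>(i, j). H j (\<epsilon> * s i))) $$ (k, j) =
        mat n n (\<lambda>(k, j). \<epsilon> ^ k * 1 * (h k j + N \<epsilon> k j)) $$ (k, j)"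
      using kj by (simp add: scalar_prod_def atLeast0LessThan algebra_simps)
  qed auto
  have "\<forall>\<^sub>F \<epsilon> in at_right 0. det (mat n n (\<lambda>(k, j). h k j + N \<epsilon> k j)) \<ge> 0"
    using pos eventually_at_right_less[of 0]
  proof eventually_elim
    case (elim \<epsilon>)
    have "det (mat n n (\<lambda>(k, i). W k i)) * det (mat n n (\<lambda>(i, j). H j (\<epsilon> * s i))) =
        (\<Prod>k<n. \<epsilon> ^ k) * det (mat n n (\<lambda>(k, j). h k j + N \<epsilon> k j))"
      using det_mult[of "mat n n (\<lambda>(k, i). W k i)" n "mat n n (\<lambda>(i, j). H j (\<epsilon> * s i))"]
        det_scale_rows_cols[of n "\<lambda>k. \<epsilon> ^ k" "\<lambda>_. 1" "\<lambda>k j. h k j + N \<epsilon> k j"]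
      by (simp add: prod_eq[OF elim(2)])
    moreover have "(\<Prod>k<n. \<epsilon> ^ k) > 0"
      using elim by (intro prod_pos) auto
    ultimately show ?case
      using mult_pos_pos[OF W_pos elim(1)] by (simp add: zero_less_mult_iff)
  qed
  moreover have "((\<lambda>\<epsilon>. det (mat n n (\<lambda>(k, j). h k j + N \<epsilon> k j)))
      \<longlongrightarrow> det (mat n n (\<lambda>(k, j). h k j + 0))) (at_right 0)"
    by (intro tendsto_det tendsto_intros N_lim)
  ultimately show ?thesis
    by (auto intro!: tendsto_lowerbound[of _ _ "at_right (0::real)"])
qed

text \<open>The Taylor coefficients of \<open>x \<mapsto> test_kernel d b y x v powr a\<close> at \<open>0\<close>, for \<open>k < 4\<close>.\<close>

definition test_coeff :: "real \<Rightarrow> real \<Rightarrow> real \<Rightarrow> real \<Rightarrow> nat \<Rightarrow> real \<Rightarrow> real" where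
  "test_coeff a d b y k v =
     [1,
      a * (d * v),
      a * (d * v\<^sup>2 + b * v + y * v ^ 3) + a * (a - 1) / 2 * (d * v)\<^sup>2,
      a * (d * v ^ 3) + a * (a - 1) * (d * v) * (d * v\<^sup>2 + b * v + y * v ^ 3)
        + a * (a - 1) * (a - 2) / 6 * (d * v) ^ 3] ! k"

text \<open>Write the kernel as \<open>1 + x * X x\<close>, where \<open>X x\<close> tends to
  \<open>d * v\<close>, and substitute \<open>x * X x\<close> into the cubic expansion
  \<open>P\<close> of \<open>(1 + t) powr a\<close>. Truncating \<open>P (x * X x)\<close> at degree
  3 in \<open>x\<close> costs \<open>x ^ 4\<close> times a bounded factor.\<close>

lemma test_kernel_powr_Taylor:
  assumes "d > 0" and "v \<in> {0<..<1}"
  shows "((\<lambda>x. (test_kernel d b y x v powr a - (\<Sum>k<4. test_coeff a d b y k v * x ^ k)) / x ^ 3)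
           \<longlongrightarrow> 0) (at_right 0)"
proof -
  define t1 t2 t3 where "t1 = d * v" and "t2 = d * v\<^sup>2 + b * v + y * v ^ 3" and "t3 = d * v ^ 3"
  \<comment> \<open>\<open>\<rho> x * x ^ 4\<close> is the tail of the geometric part of the kernel
    from degree 4 on.\<close>
  define \<rho> where "\<rho> x = d * v ^ 4 / (1 - v * x)" for x
  define S where "S x = t2 + t3 * x + \<rho> x * x\<^sup>2" for x
  define X where "X x = t1 + x * S x" for x
  define C2 C3 where "C2 = a * (a - 1) / 2" and "C3 = a * (a - 1) * (a - 2) / 6"
  define P where "P t = 1 + a * t + C2 * t\<^sup>2 + C3 * t ^ 3" for t
  have "t1 > 0" using assms by (simp add: t1_def)
  have \<rho>_lim: "(\<rho> \<longlongrightarrow> d * v ^ 4 / (1 - v * 0)) (at_right 0)"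
    unfolding \<rho>_def by (intro tendsto_intros) auto
  have S_lim: "(S \<longlongrightarrow> t2 + t3 * 0 + d * v ^ 4 / (1 - v * 0) * 0\<^sup>2) (at_right 0)"
    unfolding S_def by (intro tendsto_intros \<rho>_lim)
  have X_lim: "(X \<longlongrightarrow> t1) (at_right 0)"
    unfolding X_def by (rule tendsto_eq_intros S_lim refl)+ simp
  have ev01: "\<forall>\<^sub>F x in at_right 0. x \<in> {0<..<1::real}"
    by (rule eventually_at_right_real) simp
  have ev: "\<forall>\<^sub>F x in at_right 0. test_kernel d b y x v = 1 + x * X x"
    using ev01
  proof eventually_elim
    case (elim x)
    have "v * x < 1"
      using elim assms mult_strict_mono[of v 1 x 1] by auto
    then show ?case
      by (simp add: test_kernel_def X_def S_def \<rho>_def t1_def t2_def t3_def field_simps eval_nat_numeral)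
  qed
  \<comment> \<open>Since \<open>t1 > 0\<close>, the substituted quantity approaches 0 from the
    right, so a one-sided expansion of \<open>powr\<close> suffices.\<close>
  have xX_lim: "filterlim (\<lambda>x. x * X x) (at_right 0) (at_right 0)"
  proof -
    have "((\<lambda>x. x * X x) \<longlongrightarrow> 0) (at_right 0)"
      by (rule tendsto_eq_intros X_lim refl)+ simp
    moreover have "\<forall>\<^sub>F x in at_right 0. x * X x > 0"
      using eventually_at_right_less[of 0] order_tendstoD(1)[OF X_lim \<open>t1 > 0\<close>]
      by eventually_elim simp
    ultimately show ?thesis
      by (auto simp: filterlim_at elim: eventually_mono)
  qed
  have powr_lim: "((\<lambda>t. ((1 + t) powr a - P t) / t ^ 3) \<longlongrightarrow> 0) (at_right 0)"
    unfolding P_def C2_def C3_def by real_asymp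
  have "((\<lambda>x. ((1 + x * X x) powr a - P (x * X x)) / (x * X x) ^ 3 * X x ^ 3) \<longlongrightarrow> 0 * t1 ^ 3) (at_right 0)"
    by (intro tendsto_intros X_lim filterlim_compose[OF powr_lim xX_lim])
  moreover have "((\<lambda>x. x * (a * \<rho> x + C2 * (2 * t1 * (t3 + \<rho> x * x) + (S x)\<^sup>2)
      + C3 * (3 * t1\<^sup>2 * S x + 3 * t1 * x * (S x)\<^sup>2 + x\<^sup>2 * S x ^ 3))) \<longlongrightarrow> 0) (at_right 0)"
    by (rule tendsto_eq_intros S_lim \<rho>_lim refl)+ simp
  ultimately have "((\<lambda>x. ((1 + x * X x) powr a - P (x * X x)) / (x * X x) ^ 3 * X x ^ 3
      + x * (a * \<rho> x + C2 * (2 * t1 * (t3 + \<rho> x * x) + (S x)\<^sup>2)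
      + C3 * (3 * t1\<^sup>2 * S x + 3 * t1 * x * (S x)\<^sup>2 + x\<^sup>2 * S x ^ 3))) \<longlongrightarrow> 0 * t1 ^ 3 + 0) (at_right 0)"
    by (rule tendsto_add)
  moreover have "\<forall>\<^sub>F x in at_right 0.
      ((1 + x * X x) powr a - P (x * X x)) / (x * X x) ^ 3 * X x ^ 3
      + x * (a * \<rho> x + C2 * (2 * t1 * (t3 + \<rho> x * x) + (S x)\<^sup>2)
      + C3 * (3 * t1\<^sup>2 * S x + 3 * t1 * x * (S x)\<^sup>2 + x\<^sup>2 * S x ^ 3)) =
      (test_kernel d b y x v powr a - (\<Sum>k<4. test_coeff a d b y k v * x ^ k)) / x ^ 3"
    using ev eventually_at_right_less[of 0] order_tendstoD(1)[OF X_lim \<open>t1 > 0\<close>]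
  proof eventually_elim
    case (elim x)
    have coeffs: "(\<Sum>k<4. test_coeff a d b y k v * x ^ k) =
        1 + a * t1 * x + (a * t2 + C2 * t1\<^sup>2) * x\<^sup>2 + (a * t3 + 2 * C2 * t1 * t2 + C3 * t1 ^ 3) * x ^ 3"
      by (simp add: test_coeff_def t1_def t2_def t3_def C2_def C3_def eval_nat_numeral)
    have "P (x * X x) - (\<Sum>k<4. test_coeff a d b y k v * x ^ k) =
        x ^ 4 * (a * \<rho> x + C2 * (2 * t1 * (t3 + \<rho> x * x) + (S x)\<^sup>2)
          + C3 * (3 * t1\<^sup>2 * S x + 3 * t1 * x * (S x)\<^sup>2 + x\<^sup>2 * S x ^ 3))"
    proof -
      \<comment> \<open>Eliminating \<open>t2\<close> in favour of \<open>S x\<close> makes the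
        claim a polynomial identity with \<open>S x\<close> and \<open>\<rho> x\<close> as
        atoms.\<close>
      have "S x = t2 + x * (t3 + \<rho> x * x)"
        by (simp add: S_def power2_eq_square algebra_simps)
      then have t2_eq: "t2 = S x - x * (t3 + \<rho> x * x)" by simp
      show ?thesis
        unfolding coeffs P_def X_def t2_eq
        by (simp add: eval_nat_numeral algebra_simps)
    qed
    then have "x * (a * \<rho> x + C2 * (2 * t1 * (t3 + \<rho> x * x) + (S x)\<^sup>2)
          + C3 * (3 * t1\<^sup>2 * S x + 3 * t1 * x * (S x)\<^sup>2 + x\<^sup>2 * S x ^ 3)) =
        (P (x * X x) - (\<Sum>k<4. test_coeff a d b y k v * x ^ k)) / x ^ 3"
      using elim by (simp add: eval_nat_numeral)
    moreover have "((1 + x * X x) powr a - P (x * X x)) / (x * X x) ^ 3 * X x ^ 3 =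
        ((1 + x * X x) powr a - P (x * X x)) / x ^ 3"
      using elim by (simp add: power_mult_distrib)
    ultimately show ?case
      by (simp add: elim(1) diff_divide_distrib)
  qed
  ultimately show ?thesis
    by (simp add: tendsto_cong)
qed

section \<open>The determinant of the Taylor coefficients and its sign\<close>

lemma det_mat_Suc:
  "det (mat (Suc n) (Suc n) (\<lambda>(i, j). M i j)) =
     (\<Sum>j\<le>n. M 0 j * ((-1) ^ j * det (mat n n (\<lambda>(i, k). M (Suc i) (if k < j then k else Suc k)))))"
proof -
  have "mat_delete (mat (Suc n) (Suc n) (\<lambda>(i, j). M i j)) 0 j =
      mat n n (\<lambda>(i, k). M (Suc i) (if k < j then k else Suc k))" if "j < Suc n" for j
    unfolding mat_delete_def using that by (intro eq_matI) auto
  then show ?thesis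
    by (subst laplace_expansion_row[of _ "Suc n" 0])
       (auto simp: cofactor_def lessThan_Suc_atMost[symmetric])
qed

text \<open>The entries are polynomials in \<open>v j\<close>, so the matrix factors through the
  Vandermonde matrix of the nodes, of determinant \<open>V\<close>. The numbers \<open>V\<close>,
  \<open>e1\<close>, \<open>e2\<close> depend on the nodes alone, which lets \<open>d\<close>,
  \<open>b\<close>, \<open>y\<close> be chosen afterwards.\<close>

lemma det_test_coeff:
  assumes v: "strict_mono_on {..<4} v" "\<And>j. j < 4 \<Longrightarrow> v j > 0"
  obtains V e1 e2 where "V > 0"
    and "\<And>a d b y. det (mat 4 4 (\<lambda>(k, j). test_coeff a d b y k (v j))) = V * (a * d) *
      ((a * d + a * (a - 1) / 2 * d\<^sup>2)
          * (a * d + a * (a - 1) * d\<^sup>2 + a * (a - 1) * (a - 2) / 6 * d ^ 3 + a * (a - 1) * d * y * e1)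
        - a * y * (a * (a - 1) * d * b - a * (a - 1) * d * y * e2))"
proof -
  define e1 e2 e3 e4 where "e1 = v 0 + v 1 + v 2 + v 3"
    and "e2 = v 0 * v 1 + v 0 * v 2 + v 0 * v 3 + v 1 * v 2 + v 1 * v 3 + v 2 * v 3"
    and "e3 = v 0 * v 1 * v 2 + v 0 * v 1 * v 3 + v 0 * v 2 * v 3 + v 1 * v 2 * v 3"
    and "e4 = v 0 * v 1 * v 2 * v 3"
  define V where "V = det (mat 4 4 (\<lambda>(l, j). v j ^ l))"
  have "V > 0"
    unfolding V_def using det_monomials_pos[of 4 id v] v by (simp add: strict_mono_on_def)
  have det_C: "det (mat 4 4 (\<lambda>(k, l). [[1,0,0,0],[0,A,0,0],[0,B,X,Y],[D,E,P,Q]] ! k ! l)) = A * (X * Q - Y * P)"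
    for A B X Y D E P Q :: real
    by (simp add: eval_nat_numeral det_mat_Suc)
  \<comment> \<open>The last row of the coefficient matrix involves \<open>v\<^sup>4\<close>; on the four nodes this is a cubic, with the
    elementary symmetric polynomials \<open>e1, ..., e4\<close> as coefficients.\<close>
  have quartic: "v j ^ 4 = e1 * v j ^ 3 - e2 * v j ^ 2 + e3 * v j - e4" if "j < 4" for j
  proof -
    have "j = 0 \<or> j = 1 \<or> j = 2 \<or> j = 3"
      using that by auto
    then show ?thesis
      unfolding e1_def e2_def e3_def e4_def by (elim disjE) (simp_all add: eval_nat_numeral algebra_simps)
  qed
  have "det (mat 4 4 (\<lambda>(k, j). test_coeff a d b y k (v j))) = V * (a * d) *
      ((a * d + a * (a - 1) / 2 * d\<^sup>2)
          * (a * d + a * (a - 1) * d\<^sup>2 + a * (a - 1) * (a - 2) / 6 * d ^ 3 + a * (a - 1) * d * y * e1)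
        - a * y * (a * (a - 1) * d * b - a * (a - 1) * d * y * e2))" for a d b y
  proof -
    define R where "R = a * (a - 1) * d * y"
    define C where "C = [[1, 0, 0, 0], [0, a * d, 0, 0],
      [0, a * b, a * d + a * (a - 1) / 2 * d\<^sup>2, a * y],
      [- R * e4, R * e3, a * (a - 1) * d * b - R * e2,
        a * d + a * (a - 1) * d\<^sup>2 + a * (a - 1) * (a - 2) / 6 * d ^ 3 + R * e1]]"
    have entry: "(\<Sum>l<4. C ! k ! l * v j ^ l) = test_coeff a d b y k (v j)" if "k < 4" "j < 4" for k j
    proof -
      have "k = 0 \<or> k = 1 \<or> k = 2 \<or> k = 3"
        using that by auto
      moreover have "(\<Sum>l<4. C ! 3 ! l * v j ^ l) = test_coeff a d b y 3 (v j)"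
      proof -
        have "(\<Sum>l<4. C ! 3 ! l * v j ^ l) = a * (a - 1) * d * b * v j ^ 2
            + (a * d + a * (a - 1) * d\<^sup>2 + a * (a - 1) * (a - 2) / 6 * d ^ 3) * v j ^ 3
            + R * (e1 * v j ^ 3 - e2 * v j ^ 2 + e3 * v j - e4)"
          by (simp add: C_def eval_nat_numeral algebra_simps)
        also have "\<dots> = test_coeff a d b y 3 (v j)"
          unfolding quartic[OF \<open>j < 4\<close>, symmetric] R_def
          by (simp add: test_coeff_def eval_nat_numeral field_simps)
        finally show ?thesis .
      qed
      ultimately show ?thesis
        by (elim disjE) (simp_all add: C_def test_coeff_def eval_nat_numeral algebra_simps)
    qed
    have "mat 4 4 (\<lambda>(k, j). test_coeff a d b y k (v j)) =
        mat 4 4 (\<lambda>(k, l). C ! k ! l) * mat 4 4 (\<lambda>(l, j). v j ^ l)"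
      by (rule eq_matI) (use entry in \<open>simp_all add: scalar_prod_def atLeast0LessThan\<close>)
    then have "det (mat 4 4 (\<lambda>(k, j). test_coeff a d b y k (v j))) = det (mat 4 4 (\<lambda>(k, l). C ! k ! l)) * V"
      unfolding V_def by (simp add: det_mult[of _ 4])
    then show ?thesis
      unfolding C_def det_C R_def by (simp add: algebra_simps)
  qed
  then show thesis
    using that \<open>V > 0\<close> by blast
qed

lemma ex_det_test_coeff_neg:
  assumes v: "strict_mono_on {..<4} v" "\<And>j. j < 4 \<Longrightarrow> v j > 0" and "a > 0" "a \<noteq> 1"
  obtains d b y where "d > 0" "b \<ge> 0" "y \<ge> 0"
    and "det (mat 4 4 (\<lambda>(k, j). test_coeff a d b y k (v j))) < 0"
proof -
  obtain V e1 e2 where "V > 0"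
    and V: "\<And>a d b y. det (mat 4 4 (\<lambda>(k, j). test_coeff a d b y k (v j))) = V * (a * d) *
      ((a * d + a * (a - 1) / 2 * d\<^sup>2)
          * (a * d + a * (a - 1) * d\<^sup>2 + a * (a - 1) * (a - 2) / 6 * d ^ 3 + a * (a - 1) * d * y * e1)
        - a * y * (a * (a - 1) * d * b - a * (a - 1) * d * y * e2))"
    using det_test_coeff[OF v] by metis
  show thesis
  proof (cases "a > 1")
    case True
    \<comment> \<open>\<open>Z\<close> is the bracket of the formula at \<open>d = y = 1\<close> and
      \<open>b = 0\<close>. The bracket decreases linearly in \<open>b\<close>, and the chosen
      \<open>b\<close> makes it at most -1.\<close>
    define Z where "Z = (a + a * (a - 1) / 2) *
      (a + a * (a - 1) + a * (a - 1) * (a - 2) / 6 + a * (a - 1) * e1) + a * (a * (a - 1) * e2)"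
    define b where "b = (\<bar>Z\<bar> + 1) / (a * (a * (a - 1)))"
    have "b \<ge> 0"
      using True by (simp add: b_def)
    have "det (mat 4 4 (\<lambda>(k, j). test_coeff a 1 b 1 k (v j))) = V * a * (Z - a * (a * (a - 1)) * b)"
      unfolding V Z_def by (simp add: algebra_simps)
    also have "a * (a * (a - 1)) * b = \<bar>Z\<bar> + 1"
      using True by (simp add: b_def)
    also have "V * a * (Z - (\<bar>Z\<bar> + 1)) < 0"
      using \<open>V > 0\<close> \<open>a > 0\<close> by (intro mult_pos_neg) auto
    finally show thesis
      using that[of 1 b 1] \<open>b \<ge> 0\<close> by simp
  next
    case False
    \<comment> \<open>With \<open>(a - 1) * d = - 6\<close> the two factors become
      \<open>- 2 * (a * d)\<close> and \<open>a * d * (d + 1)\<close>, of opposite signs.\<close>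
    define d where "d = 6 / (1 - a)"
    have "d > 0" and d: "(a - 1) * d = - 6" "(a - 2) * d = - 6 - d"
      using False \<open>a \<noteq> 1\<close> by (auto simp: d_def field_simps)
    have "a * d + a * (a - 1) / 2 * d\<^sup>2 = a * d * (1 + (a - 1) * d / 2)"
      by (simp add: power2_eq_square algebra_simps)
    then have "a * d + a * (a - 1) / 2 * d\<^sup>2 = - 2 * (a * d)"
      unfolding d by simp
    moreover have "a * d + a * (a - 1) * d\<^sup>2 + a * (a - 1) * (a - 2) / 6 * d ^ 3 =
        a * d * (1 + (a - 1) * d + (a - 1) * d * ((a - 2) * d) / 6)"
      by (simp add: eval_nat_numeral algebra_simps)
    then have "a * d + a * (a - 1) * d\<^sup>2 + a * (a - 1) * (a - 2) / 6 * d ^ 3 = a * d * (d + 1)"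
      unfolding d by simp
    moreover have "det (mat 4 4 (\<lambda>(k, j). test_coeff a d 0 0 k (v j))) =
        V * (a * d) * ((a * d + a * (a - 1) / 2 * d\<^sup>2)
          * (a * d + a * (a - 1) * d\<^sup>2 + a * (a - 1) * (a - 2) / 6 * d ^ 3))"
      unfolding V by simp
    ultimately have "det (mat 4 4 (\<lambda>(k, j). test_coeff a d 0 0 k (v j))) =
        V * (a * d) * ((- 2 * (a * d)) * (a * d * (d + 1)))"
      by (simp only:)
    also have "\<dots> < 0"
      using \<open>V > 0\<close> \<open>a > 0\<close> \<open>d > 0\<close> by (intro mult_pos_neg mult_neg_pos) auto
    finally show thesis
      using that[of d 0 0] \<open>d > 0\<close> by simp
  qed
qed

subsection \<open>Preservers of order two\<close>

text \<open>Sums of any length allow repeated terms, and thereby the comparison of \<open>G\<close>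
  along rational multiples.\<close>

lemma sum_less_of_pairwise:
  fixes G :: "real \<Rightarrow> real" and f g :: "nat \<Rightarrow> real"
  assumes G: "\<And>a b c d. b + c < a + d \<Longrightarrow> G b + G c < G a + G d"
    and "(\<Sum>i<n. f i) < (\<Sum>i<n. g i)"
  shows "(\<Sum>i<n. G (f i)) < (\<Sum>i<n. G (g i))"
  using assms(2)
proof (induction n arbitrary: g)
  case 0
  then show ?case by simp
next
  case (Suc n)
  show ?case
  proof (cases n)
    case 0
    then show ?thesis
      using Suc.prems G[of "f 0" "f 0" "g 0" "g 0"] by simp
  next
    case (Suc m)
    \<comment> \<open>Replace the two last terms \<open>g m, g n\<close> by \<open>c, f n\<close>, giving away only half of the slack.\<close>
    define \<eta> where "\<eta> = ((\<Sum>i<Suc n. g i) - (\<Sum>i<Suc n. f i)) / 2"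
    have "\<eta> > 0" using Suc.prems by (simp add: \<eta>_def)
    define c where "c = g m + g n - f n - \<eta>"
    have "(\<Sum>i<n. f i) < (\<Sum>i<n. (g(m := c)) i)"
      using \<open>\<eta> > 0\<close> by (simp add: Suc c_def \<eta>_def field_simps)
    then have "(\<Sum>i<n. G (f i)) < (\<Sum>i<n. G ((g(m := c)) i))"
      by (rule Suc.IH)
    moreover have "G (f n) + G c < G (g m) + G (g n)"
      by (rule G) (use \<open>\<eta> > 0\<close> in \<open>simp add: c_def\<close>)
    ultimately show ?thesis
      by (simp add: Suc)
  qed
qed

text \<open>Sums with repeated terms show that \<open>(G t - G 0) / (G 1 - G 0)\<close> lies on the
  same side of every rational other than \<open>t\<close> as \<open>t\<close> does; density of the
  rationals makes the two equal.\<close>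

lemma affine_of_pairwise:
  fixes G :: "real \<Rightarrow> real"
  assumes G: "\<And>a b c d. b + c < a + d \<Longrightarrow> G b + G c < G a + G d"
  obtains \<alpha> \<beta> where "\<alpha> > 0" and "\<And>t. G t = \<beta> + \<alpha> * t"
proof -
  have G_mono: "G s < G t" if "s < t" for s t
    using G[of s s t t] that by simp
  have blocks: "n * G x + m * G y < n * G x' + m * G y'"
    if "n * x + m * y < n * x' + m * y'" for n m :: nat and x y x' y' :: real
  proof -
    have sum2: "(\<Sum>i<n + m. if i < n then z else w) = n * z + m * w" for z w :: real
      by (induction m) (auto simp: algebra_simps)
    show ?thesis
      using sum_less_of_pairwise[where G = G and f = "\<lambda>i. if i < n then x else y" and n = "n + m"
          and g = "\<lambda>i. if i < n then x' else y'", OF G] that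
      by (simp add: if_distrib[of G] sum2)
  qed
  have rational: "(r < t \<longrightarrow> r * (G 1 - G 0) < G t - G 0) \<and> (t < r \<longrightarrow> G t - G 0 < r * (G 1 - G 0))"
    if "r \<in> \<rat>" for r t
  proof -
    obtain p q :: int where "q > 0" and r: "r = p / q"
      using \<open>r \<in> \<rat>\<close> by (metis Rats_cases')
    then obtain n :: nat where n: "q = int n" "n > 0"
      by (metis pos_int_cases)
    have eqs: "r < x \<longleftrightarrow> p < n * x" "x < r \<longleftrightarrow> n * x < p"
      "r * D < x \<longleftrightarrow> p * D < n * x" "x < r * D \<longleftrightarrow> n * x < p * D" for x D :: real
      using n r by (simp_all add: pos_divide_less_eq pos_less_divide_eq mult.commute)
    show ?thesis
    \<comment> \<open>Multiplicities are natural numbers, so the sign of \<open>p\<close> decides on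
      which side of the inequality the \<open>m\<close> copies of 1 are placed.\<close>
    proof (cases "p \<ge> 0")
      case True
      then obtain m :: nat where "p = int m"
        using nonneg_int_cases by blast
      then show ?thesis
        unfolding eqs using blocks[of n 0 m 1 t 0] blocks[of n t m 0 0 1] by (auto simp: algebra_simps)
    next
      case False
      then obtain m :: nat where "p = - int m"
        by (metis le_cases nonpos_int_cases)
      then show ?thesis
        unfolding eqs using blocks[of n 0 m 0 t 1] blocks[of n t m 1 0 0] by (auto simp: algebra_simps)
    qed
  qed
  have "G 1 - G 0 > 0"
    using G_mono[of 0 1] by simp
  have "(G t - G 0) / (G 1 - G 0) = t" for t
  proof (rule ccontr)
    assume "(G t - G 0) / (G 1 - G 0) \<noteq> t"
    then consider "(G t - G 0) / (G 1 - G 0) < t" | "t < (G t - G 0) / (G 1 - G 0)"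
      by linarith
    then show False
    proof cases
      case 1
      then obtain r where "r \<in> \<rat>" "(G t - G 0) / (G 1 - G 0) < r" "r < t"
        using Rats_dense_in_real by blast
      then show False
        using rational[of r t] \<open>G 1 - G 0 > 0\<close> by (simp add: divide_less_eq)
    next
      case 2
      then obtain r where "r \<in> \<rat>" "t < r" "r < (G t - G 0) / (G 1 - G 0)"
        using Rats_dense_in_real by blast
      then show False
        using rational[of r t] \<open>G 1 - G 0 > 0\<close> by (simp add: less_divide_eq)
    qed
  qed
  then have "G t = G 0 + (G 1 - G 0) * t" for t
    using \<open>G 1 - G 0 > 0\<close> by (metis add.commute diff_add_cancel less_irrefl nonzero_eq_divide_eq mult.commute)
  then show thesis
    using that \<open>G 1 - G 0 > 0\<close> by blast
qed

section \<open>Positivity, minors of order two and order embeddings\<close>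

lemma TP_order_pos:
  assumes "TP_order p X Y K" and "p \<ge> 1" and "x \<in> X" and "y \<in> Y"
  shows "K (x, y) > 0"
proof -
  have "strict_mono_on {..<1::nat} (\<lambda>_. x)" "strict_mono_on {..<1::nat} (\<lambda>_. y)"
    by (auto intro!: strict_mono_onI)
  then have "det (mat 1 1 (\<lambda>(i, j). K (x, y))) > 0"
    using assms(1)[unfolded TP_order_def, rule_format, of 1 "\<lambda>_. x" "\<lambda>_. y"] assms(2-)
    by (simp only: image_subset_iff) blast
  then show ?thesis
    by (simp add: det_mat_Suc)
qed

lemma TP_order_2_minor:
  assumes "TP_order p X Y K" and "p \<ge> 2"
    and "x0 \<in> X" "x1 \<in> X" "x0 < x1" "y0 \<in> Y" "y1 \<in> Y" "y0 < y1"
  shows "K (x0, y1) * K (x1, y0) < K (x0, y0) * K (x1, y1)"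
proof -
  have "det (mat 2 2 (\<lambda>(i, j). K (if i = 0 then x0 else x1, if j = 0 then y0 else y1))) > 0"
    using assms(1)[unfolded TP_order_def, rule_format, of 2
        "\<lambda>i. if i = 0 then x0 else x1" "\<lambda>j. if j = 0 then y0 else y1"] assms(2-)
    by (auto simp: strict_mono_on_def)
  then show ?thesis
    by (simp add: det_mat_Suc eval_nat_numeral)
qed

lemma infinite_ex_increasing:
  fixes X :: "'a::linorder set" and n :: nat
  assumes "infinite X"
  obtains x where "x ` {..<n} \<subseteq> X" and "strict_mono_on {..<n} x"
proof -
  obtain A where A: "finite A" "A \<subseteq> X" "card A = n"
    using infinite_arbitrarily_large[OF assms] by metis
  show thesis
  proof (rule that)
    show "(\<lambda>i. sorted_list_of_set A ! i) ` {..<n} \<subseteq> X"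
      using A nth_mem[of _ "sorted_list_of_set A"] by fastforce
    show "strict_mono_on {..<n} (\<lambda>i. sorted_list_of_set A ! i)"
      using A sorted_wrt_nth_less[OF strict_sorted_list_of_set[of A]] by (auto simp: strict_mono_on_def)
  qed
qed

text \<open>By the minors of order two, the quotient \<open>r\<close> of \<open>K (s, y 1)\<close>
  by \<open>K (s, y 0)\<close> increases strictly with \<open>s\<close>, and
  \<open>r / (1 + r)\<close> carries it into the unit interval. The same works with two fixed
  rows.\<close>

lemma TP_2_embedding:
  fixes X :: "'a::linorder set" and Y :: "'b::linorder set"
  assumes K: "TP_order 2 X Y K" and "infinite X" and "infinite Y"
  obtains \<phi> \<psi> :: "_ \<Rightarrow> real" where "strict_mono_on X \<phi>" "\<phi> ` X \<subseteq> {0<..<1}"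
    and "strict_mono_on Y \<psi>" "\<psi> ` Y \<subseteq> {0<..<1}"
proof -
  obtain x where x: "x ` {..<2} \<subseteq> X" "strict_mono_on {..<2::nat} x"
    using infinite_ex_increasing[OF \<open>infinite X\<close>] by metis
  obtain y where y: "y ` {..<2} \<subseteq> Y" "strict_mono_on {..<2::nat} y"
    using infinite_ex_increasing[OF \<open>infinite Y\<close>] by metis
  have x01: "x 0 \<in> X" "x 1 \<in> X" "x 0 < x 1" and y01: "y 0 \<in> Y" "y 1 \<in> Y" "y 0 < y 1"
    using x y by (auto dest: strict_mono_onD[of _ _ 0 1])
  have pos: "K (s, t) > 0" if "s \<in> X" "t \<in> Y" for s t
    using TP_order_pos[OF K] that by simp
  show thesis
  proof (rule that)
    show "strict_mono_on X (\<lambda>s. K (s, y 1) / (K (s, y 0) + K (s, y 1)))"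
    proof (rule strict_mono_onI)
      fix s s' assume s: "s \<in> X" "s' \<in> X" "s < s'"
      show "K (s, y 1) / (K (s, y 0) + K (s, y 1)) < K (s', y 1) / (K (s', y 0) + K (s', y 1))"
        using TP_order_2_minor[OF K _ s y01] s y01 pos[of s "y 0"] pos[of s "y 1"]
          pos[of s' "y 0"] pos[of s' "y 1"]
        by (simp add: divide_less_eq less_divide_eq add_pos_pos algebra_simps)
    qed
    show "strict_mono_on Y (\<lambda>t. K (x 1, t) / (K (x 0, t) + K (x 1, t)))"
    proof (rule strict_mono_onI)
      fix t t' assume t: "t \<in> Y" "t' \<in> Y" "t < t'"
      show "K (x 1, t) / (K (x 0, t) + K (x 1, t)) < K (x 1, t') / (K (x 0, t') + K (x 1, t'))"
        using TP_order_2_minor[OF K _ x01 t] t x01 pos[of "x 0" t] pos[of "x 1" t]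
          pos[of "x 0" t'] pos[of "x 1" t']
        by (simp add: divide_less_eq less_divide_eq add_pos_pos algebra_simps)
    qed
  qed (use pos x01 y01 in \<open>auto simp: divide_less_eq add_pos_pos\<close>)
qed

subsection \<open>Totally positive kernels on ordered sets\<close>

lemma totally_positive_iff:
  "totally_positive X Y K \<longleftrightarrow>
     (\<forall>n x y. 1 \<le> n \<longrightarrow> x ` {..<n} \<subseteq> X \<longrightarrow> strict_mono_on {..<n} x \<longrightarrow>
        y ` {..<n} \<subseteq> Y \<longrightarrow> strict_mono_on {..<n} y \<longrightarrow>
        det (mat n n (\<lambda>(i, j). K (x i, y j))) > 0)"
  unfolding totally_positive_def TP_order_def by blast

text \<open>The terms with \<open>A\<close>, \<open>B\<close> and \<open>C\<close> only scale rows
  and columns by positive factors; \<open>D\<close> is absorbed into the nodes.\<close>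

lemma totally_positive_exp_bilinear:
  fixes \<sigma> :: "'a::linorder \<Rightarrow> real" and \<tau> :: "'b::linorder \<Rightarrow> real"
  assumes "strict_mono_on X \<sigma>" and "strict_mono_on Y \<tau>" and "D > 0"
  shows "totally_positive X Y (\<lambda>(x, y). exp (A + B * \<sigma> x + C * \<tau> y + D * \<sigma> x * \<tau> y))"
  unfolding totally_positive_iff
proof (intro allI impI)
  fix n and x :: "nat \<Rightarrow> 'a" and y :: "nat \<Rightarrow> 'b"
  assume x: "x ` {..<n} \<subseteq> X" "strict_mono_on {..<n} x"
    and y: "y ` {..<n} \<subseteq> Y" "strict_mono_on {..<n} y"
  have "strict_mono_on {..<n} (\<lambda>i. D * \<sigma> (x i))" "strict_mono_on {..<n} (\<lambda>j. \<tau> (y j))"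
    using assms x y by (auto simp: strict_mono_on_def image_subset_iff)
  then have "det (mat n n (\<lambda>(i, j). exp (D * \<sigma> (x i) * \<tau> (y j)))) > 0"
    by (rule det_exp_kernel_pos)
  then have "det (mat n n (\<lambda>(i, j). exp (A + B * \<sigma> (x i)) * exp (C * \<tau> (y j))
      * exp (D * \<sigma> (x i) * \<tau> (y j)))) > 0"
    unfolding det_scale_rows_cols[of n "\<lambda>i. exp (A + B * \<sigma> (x i))" "\<lambda>j. exp (C * \<tau> (y j))"
        "\<lambda>i j. exp (D * \<sigma> (x i) * \<tau> (y j))"]
    by (intro mult_pos_pos prod_pos) auto
  then show "det (mat n n (\<lambda>(i, j). case (x i, y j) of (x, y) \<Rightarrow>
      exp (A + B * \<sigma> x + C * \<tau> y + D * \<sigma> x * \<tau> y))) > 0"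
    by (simp add: exp_add)
qed

lemma totally_positive_test_kernel:
  fixes \<sigma> :: "'a::linorder \<Rightarrow> real" and \<tau> :: "'b::linorder \<Rightarrow> real"
  assumes "strict_mono_on X \<sigma>" "\<sigma> ` X \<subseteq> {0<..<1}" and "strict_mono_on Y \<tau>" "\<tau> ` Y \<subseteq> {0<..<1}"
    and "d > 0" "b \<ge> 0" "c \<ge> 0"
  shows "totally_positive X Y (\<lambda>(x, y). test_kernel d b c (\<sigma> x) (\<tau> y))"
  unfolding totally_positive_iff
proof (intro allI impI)
  fix n and x :: "nat \<Rightarrow> 'a" and y :: "nat \<Rightarrow> 'b"
  assume x: "x ` {..<n} \<subseteq> X" "strict_mono_on {..<n} x"
    and y: "y ` {..<n} \<subseteq> Y" "strict_mono_on {..<n} y"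
  show "det (mat n n (\<lambda>(i, j). case (x i, y j) of (x, y) \<Rightarrow> test_kernel d b c (\<sigma> x) (\<tau> y))) > 0"
    unfolding case_prod_conv
    by (rule det_test_kernel_pos) (use assms x y in \<open>auto simp: strict_mono_on_def image_subset_iff\<close>)
qed

lemma totally_positive_cmult:
  assumes K: "totally_positive X Y K" and "c > 0"
    and F: "\<And>t. t > 0 \<Longrightarrow> F t = c * t"
  shows "totally_positive X Y (F \<circ> K)"
  unfolding totally_positive_iff
proof (intro allI impI)
  fix n and x :: "nat \<Rightarrow> 'a" and y :: "nat \<Rightarrow> 'b"
  assume n: "1 \<le> n" and x: "x ` {..<n} \<subseteq> X" "strict_mono_on {..<n} x"
    and y: "y ` {..<n} \<subseteq> Y" "strict_mono_on {..<n} y"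
  \<comment> \<open>Needed because \<open>F\<close> is prescribed on positive arguments
    only.\<close>
  have "K (x i, y j) > 0" if "i < n" "j < n" for i j
    using K x y that unfolding totally_positive_def
    by (intro TP_order_pos[of 1 X Y]) auto
  then have "mat n n (\<lambda>(i, j). (F \<circ> K) (x i, y j)) = c \<cdot>\<^sub>m mat n n (\<lambda>(i, j). K (x i, y j))"
    by (intro eq_matI) (auto simp: F)
  then show "det (mat n n (\<lambda>(i, j). (F \<circ> K) (x i, y j))) > 0"
    using K n x y \<open>c > 0\<close> unfolding totally_positive_iff by simp
qed

lemma preserver_is_power:
  fixes X :: "'a::linorder set" and Y :: "'b::linorder set" and \<phi> :: "'a \<Rightarrow> real" and \<psi> :: "'b \<Rightarrow> real"
  assumes F_pos: "\<And>t. t > 0 \<Longrightarrow> F t > 0"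
    and F: "\<And>K. totally_positive X Y K \<Longrightarrow> TP_order 2 X Y (F \<circ> K)"
    and \<phi>: "strict_mono_on X \<phi>" and \<psi>: "strict_mono_on Y \<psi>"
    and x: "x0 \<in> X" "x1 \<in> X" "x0 < x1" and y: "y0 \<in> Y" "y1 \<in> Y" "y0 < y1"
  obtains \<alpha> c where "\<alpha> > 0" "c > 0" and "\<And>t. t > 0 \<Longrightarrow> F t = c * t powr \<alpha>"
proof -
  define G where "G t = ln (F (exp t))" for t
  have "G b + G c < G a + G d" if "b + c < a + d" for a b c d
  proof -
    \<comment> \<open>Normalized to 0 and 1 at the chosen points, so that \<open>K\<close> takes the
      values \<open>exp a\<close>, \<open>exp b\<close>, \<open>exp c\<close>, \<open>exp d\<close>
      at the four corners; the coefficient of \<open>\<sigma> s * \<tau> t\<close> is positive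
      exactly because \<open>b + c < a + d\<close>.\<close>
    define \<sigma> \<tau> where "\<sigma> s = (\<phi> s - \<phi> x0) / (\<phi> x1 - \<phi> x0)" and "\<tau> t = (\<psi> t - \<psi> y0) / (\<psi> y1 - \<psi> y0)"
      for s t
    have lt: "\<phi> x0 < \<phi> x1" "\<psi> y0 < \<psi> y1"
      using x y strict_mono_onD[OF \<phi>] strict_mono_onD[OF \<psi>] by auto
    define K where
      "K = (\<lambda>(s, t). exp (a + (c - a) * \<sigma> s + (b - a) * \<tau> t + (a + d - b - c) * \<sigma> s * \<tau> t))"
    have "totally_positive X Y K"
      unfolding K_def
      by (rule totally_positive_exp_bilinear)
         (use that lt \<phi> \<psi> in \<open>auto simp: strict_mono_on_def \<sigma>_def \<tau>_def divide_strict_right_mono\<close>)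
    then have "F (K (x0, y1)) * F (K (x1, y0)) < F (K (x0, y0)) * F (K (x1, y1))"
      using TP_order_2_minor[OF F _ x y] by simp
    moreover have "\<sigma> x0 = 0" "\<sigma> x1 = 1" "\<tau> y0 = 0" "\<tau> y1 = 1"
      using lt by (auto simp: \<sigma>_def \<tau>_def)
    ultimately have "F (exp b) * F (exp c) < F (exp a) * F (exp d)"
      by (simp add: K_def)
    then have "ln (F (exp b) * F (exp c)) < ln (F (exp a) * F (exp d))"
      by (simp add: F_pos)
    then show ?thesis
      using F_pos[of "exp a"] F_pos[of "exp b"] F_pos[of "exp c"] F_pos[of "exp d"]
      by (simp add: G_def ln_mult_pos)
  qed
  then obtain \<alpha> \<beta> where "\<alpha> > 0" and G: "\<And>t. G t = \<beta> + \<alpha> * t"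
    using affine_of_pairwise[of G] by metis
  have "F t = exp \<beta> * t powr \<alpha>" if "t > 0" for t
  proof -
    have "F t = exp (G (ln t))"
      using that F_pos by (simp add: G_def)
    then show ?thesis
      using that by (simp add: G exp_add powr_def)
  qed
  then show thesis
    using that[of \<alpha> "exp \<beta>"] \<open>\<alpha> > 0\<close> by simp
qed

text \<open>Multiplying the embedding \<open>\<phi>\<close> by a small \<open>\<epsilon>\<close>
  gives another embedding, so four fixed points of \<open>X\<close> realize the arguments
  \<open>\<epsilon> * s i\<close> shrinking to 0, as \<open>det_Taylor_coeffs_nonneg\<close>
  requires.\<close>

lemma power_preserver_exponent:
  fixes X :: "'a::linorder set" and Y :: "'b::linorder set" and \<phi> :: "'a \<Rightarrow> real" and \<psi> :: "'b \<Rightarrow> real"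
  assumes "infinite X" and "infinite Y"
    and \<phi>: "strict_mono_on X \<phi>" "\<phi> ` X \<subseteq> {0<..<1}" and \<psi>: "strict_mono_on Y \<psi>" "\<psi> ` Y \<subseteq> {0<..<1}"
    and F: "\<And>K. totally_positive X Y K \<Longrightarrow> totally_positive X Y (F \<circ> K)"
    and "\<alpha> > 0" "c > 0" and F_eq: "\<And>t. t > 0 \<Longrightarrow> F t = c * t powr \<alpha>"
  shows "\<alpha> = 1"
proof (rule ccontr)
  assume "\<alpha> \<noteq> 1"
  obtain x where x: "x ` {..<4} \<subseteq> X" "strict_mono_on {..<4::nat} x"
    using infinite_ex_increasing[OF \<open>infinite X\<close>] by metis
  obtain y where y: "y ` {..<4} \<subseteq> Y" "strict_mono_on {..<4::nat} y"
    using infinite_ex_increasing[OF \<open>infinite Y\<close>] by metis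
  define s v where "s i = \<phi> (x i)" and "v j = \<psi> (y j)" for i j
  have s: "strict_mono_on {..<4} s" "\<And>i. i < 4 \<Longrightarrow> s i \<in> {0<..<1}"
    using \<phi> x by (auto simp: s_def strict_mono_on_def image_subset_iff)
  have v: "strict_mono_on {..<4} v" "\<And>j. j < 4 \<Longrightarrow> v j \<in> {0<..<1}"
    using \<psi> y by (auto simp: v_def strict_mono_on_def image_subset_iff)
  obtain d b w where db: "d > 0" "b \<ge> 0" "w \<ge> 0"
    and neg: "det (mat 4 4 (\<lambda>(k, j). test_coeff \<alpha> d b w k (v j))) < 0"
    using ex_det_test_coeff_neg[OF v(1) _ \<open>\<alpha> > 0\<close> \<open>\<alpha> \<noteq> 1\<close>] v(2) by (metis greaterThanLessThan_iff)
  have "det (mat 4 4 (\<lambda>(k, j). test_coeff \<alpha> d b w k (v j))) \<ge> 0"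
  proof (rule det_Taylor_coeffs_nonneg[where s = s and H = "\<lambda>j x. test_kernel d b w x (v j) powr \<alpha>"])
    show "((\<lambda>x. (test_kernel d b w x (v j) powr \<alpha> - (\<Sum>k<4. test_coeff \<alpha> d b w k (v j) * x ^ k))
        / x ^ (4 - 1)) \<longlongrightarrow> 0) (at_right 0)" if "j < 4" for j
      using test_kernel_powr_Taylor[OF db(1) v(2)[OF that]] by simp
    have "\<forall>\<^sub>F \<epsilon> in at_right 0. \<epsilon> \<in> {0<..<1::real}"
      by (rule eventually_at_right_real) simp
    then show "\<forall>\<^sub>F \<epsilon> in at_right 0. det (mat 4 4 (\<lambda>(i, j). test_kernel d b w (\<epsilon> * s i) (v j) powr \<alpha>)) > 0"
    proof eventually_elim
      case (elim \<epsilon>)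
      define K where "K = (\<lambda>(s, t). test_kernel d b w (\<epsilon> * \<phi> s) (\<psi> t))"
      have "\<epsilon> * r < 1" if "0 < r" "r < 1" for r
        using elim that mult_strict_mono[of \<epsilon> 1 r 1] by auto
      then have K: "totally_positive X Y K"
        unfolding K_def
        by (intro totally_positive_test_kernel)
           (use \<phi> \<psi> db elim in \<open>auto simp: strict_mono_on_def image_subset_iff\<close>)
      have "K (x i, y j) > 0" if "i < 4" "j < 4" for i j
        using K x y that unfolding totally_positive_def
        by (intro TP_order_pos[of 1 X Y]) auto
      then have "mat 4 4 (\<lambda>(i, j). (F \<circ> K) (x i, y j)) =
          c \<cdot>\<^sub>m mat 4 4 (\<lambda>(i, j). test_kernel d b w (\<epsilon> * s i) (v j) powr \<alpha>)"
        by (intro eq_matI) (auto simp: F_eq, auto simp: K_def s_def v_def)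
      moreover have "det (mat 4 4 (\<lambda>(i, j). (F \<circ> K) (x i, y j))) > 0"
        using F[OF K] x y unfolding totally_positive_iff by auto
      ultimately show ?case
        using \<open>c > 0\<close> by (simp add: zero_less_mult_iff)
    qed
  qed (use s in auto)
  with neg show False by simp
qed

theorem theorem6p10:
  fixes X :: "'a::linorder set" and Y :: "'b::linorder set" and F :: "real \<Rightarrow> real"
  assumes "infinite X" and "infinite Y"
    and "\<exists>K. TP_order 2 X Y K"
    and "F \<in> {0<..} \<rightarrow> {0<..}"
  shows "(\<forall>K. totally_positive X Y K \<longrightarrow> totally_positive X Y (F \<circ> K)) \<longleftrightarrow>
         (\<exists>c>0. \<forall>x>0. F x = c * x)"
proof
  assume "\<exists>c>0. \<forall>x>0. F x = c * x"
  then show "\<forall>K. totally_positive X Y K \<longrightarrow> totally_positive X Y (F \<circ> K)"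
    using totally_positive_cmult by blast
next
  assume "\<forall>K. totally_positive X Y K \<longrightarrow> totally_positive X Y (F \<circ> K)"
  then have F: "\<And>K. totally_positive X Y K \<Longrightarrow> totally_positive X Y (F \<circ> K)" by blast
  \<comment> \<open>The assumed \<open>TP_order 2\<close> kernel enters through the embeddings that
    it induces.\<close>
  obtain K where "TP_order 2 X Y K"
    using assms(3) by blast
  then obtain \<phi> \<psi> :: "_ \<Rightarrow> real" where \<phi>: "strict_mono_on X \<phi>" "\<phi> ` X \<subseteq> {0<..<1}"
    and \<psi>: "strict_mono_on Y \<psi>" "\<psi> ` Y \<subseteq> {0<..<1}"
    using TP_2_embedding assms(1,2) by metis
  obtain x where x: "x ` {..<2} \<subseteq> X" "strict_mono_on {..<2::nat} x"
    using infinite_ex_increasing[OF assms(1)] by metis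
  obtain y where y: "y ` {..<2} \<subseteq> Y" "strict_mono_on {..<2::nat} y"
    using infinite_ex_increasing[OF assms(2)] by metis
  have xy: "x 0 \<in> X" "x 1 \<in> X" "x 0 < x 1" "y 0 \<in> Y" "y 1 \<in> Y" "y 0 < y 1"
    using x y by (auto dest: strict_mono_onD[of _ _ 0 1])
  have F_pos: "F t > 0" if "t > 0" for t
    using assms(4) that by auto
  \<comment> \<open>Order two already forces a power function; minors of order four then fix the
    exponent.\<close>
  have F2: "TP_order 2 X Y (F \<circ> K)" if "totally_positive X Y K" for K
    using F[OF that] by (simp add: totally_positive_def)
  obtain \<alpha> c where "\<alpha> > 0" "c > 0" and F_eq: "\<And>t. t > 0 \<Longrightarrow> F t = c * t powr \<alpha>"
    using preserver_is_power[OF F_pos F2 \<phi>(1) \<psi>(1) xy] by metis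
  have "\<alpha> = 1"
    using power_preserver_exponent[OF assms(1,2) \<phi> \<psi> F \<open>\<alpha> > 0\<close> \<open>c > 0\<close> F_eq] .
  then show "\<exists>c>0. \<forall>x>0. F x = c * x"
    using F_eq \<open>c > 0\<close> by (auto intro!: exI[of _ c])
qed

end
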